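(* Let $q$ be a complex number with $|q|<1$ and let $x$ be a nonzero complex number. Then \[ \sum_{j,\,k,\,\ell\,\geq0}\frac{(x;q^2)_k(-1)^{k}x^{-\ell}}{(q;q)_j(q^2;q^2)_k(q^2;q^2)_{\ell}} q^{(j+k+\ell)(j+k+\ell-1)+\ell^2+j+k+2\ell} =\frac{(-qx,-q^{3}/x;q^4)_{\infty}}{(q^2;q^4)_{\infty}}, \] \[ \sum_{j,\,k,\,\ell\,\geq0}\frac{(x;q^2)_k(-1)^{k}x^{-\ell}}{(q;q)_j(q^2;q^2)_k(q^2;q^2)_{\ell}} q^{(j+k+\ell)(j+k+\ell-1)+\ell^2+2j+3k+4\ell} =\frac{(-q^{3}x,-q^{5}/x;q^4)_{\infty}}{(q^2;q^4)_{\infty}}. \]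
   Context: For complex $a$ and $|q|<1$, $(a;q)_\infty=\prod_{i=0}^{\infty}(1-aq^i)$, $(a;q)_n=(a;q)_\infty/(aq^n;q)_\infty$ for nonnegative integers $n$, and $(a_1,\dots,a_r;q)_\infty=(a_1;q)_\infty\cdots(a_r;q)_\infty$. *)

theory Defs
  imports "HOL-Analysis.Analysis"
begin

definition qpoch_inf :: "complex \<Rightarrow> complex \<Rightarrow> complex" where
  "qpoch_inf a q = (\<Prod>i. 1 - a * q ^ i)"

(* The quotient (a;q)_inf / (a q^n;q)_inf degenerates to 0/0 when a q^m = 1 for some m >= n,
   so the finite symbol is given by the finite product to which that quotient reduces;
   see qpoch_eq_quotient. *)
definition qpoch :: "complex \<Rightarrow> complex \<Rightarrow> nat \<Rightarrow> complex" where
  "qpoch a q n = (\<Prod>i<n. 1 - a * q ^ i)"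

lemma convergent_prod_qpoch_inf:
  fixes a q :: complex
  assumes "norm q < 1"
  shows "convergent_prod (\<lambda>i. 1 - a * q ^ i)"
proof -
  have "summable (\<lambda>i. norm a * norm q ^ i)"
    using assms by (intro summable_mult summable_geometric) auto
  then have "summable (\<lambda>i. norm ((1 - a * q ^ i) - 1))"
    by (simp add: norm_mult norm_power)
  then show ?thesis
    by (intro abs_convergent_prod_imp_convergent_prod summable_imp_abs_convergent_prod)
qed

lemma qpoch_mult_qpoch_inf:
  fixes a q :: complex
  assumes "norm q < 1"
  shows "qpoch a q n * qpoch_inf (a * q ^ n) q = qpoch_inf a q"
proof -
  have "(\<lambda>i. 1 - a * q ^ i) has_prod
          ((\<Prod>k<n. 1 - a * q ^ k) * (\<Prod>k. 1 - a * q ^ (k + n)))"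
    by (rule has_prod_ignore_initial_segment'[OF convergent_prod_qpoch_inf[OF assms]])
  then show ?thesis
    by (simp add: qpoch_def qpoch_inf_def has_prod_iff power_add mult_ac)
qed

lemma qpoch_eq_quotient:
  fixes a q :: complex
  assumes "norm q < 1" and "qpoch_inf (a * q ^ n) q \<noteq> 0"
  shows "qpoch a q n = qpoch_inf a q / qpoch_inf (a * q ^ n) q"
  using qpoch_mult_qpoch_inf[OF assms(1), of a n] assms(2) by (simp add: field_simps)

end

theory Submission
  imports Defs
begin

text \<open>
  Put \<open>Q = q\<^sup>2\<close>, let \<open>t = 0\<close> for the first and \<open>t = 1\<close> for the second identity, and let
  \<open>n = j + k + l\<close>.
  The summand is \<open>q\<close> to the power \<open>n\<^sup>2 + t n\<close> times one coefficient from each of the series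
  \<open>1 / (z; q)\<^sub>\<infinity>\<close>, \<open>(- x q\<^sup>t z; Q)\<^sub>\<infinity> / (- q\<^sup>t z; Q)\<^sub>\<infinity>\<close> and \<open>(- q\<^bsup>2+t\<^esup> z / x; Q)\<^sub>\<infinity>\<close>.
  The product of these three series is also
  \<open>(- x q\<^sup>t z, - q\<^bsup>2+t\<^esup> z / x; Q)\<^sub>\<infinity> / ((q\<^bsup>2t\<^esup> z\<^sup>2; Q\<^sup>2)\<^sub>\<infinity> (q\<^bsup>1-t\<^esup> z; Q)\<^sub>\<infinity>)\<close>,
  which turns the triple sum into a sum over \<open>(a, b, i, h)\<close> with \<open>n = a + b + 2 i + h\<close>. Euler's
  identity evaluates the sum over \<open>h\<close> as \<open>(- Q; Q)\<^sub>\<infinity> / (- Q; Q)\<^sub>s\<close> with \<open>s = a + b + 2 i\<close>. For fixed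
  \<open>A = a + i\<close> and \<open>B = b + i\<close> the sum over \<open>i\<close> is a \<open>q\<close>-Vandermonde sum that cancels
  \<open>(- Q; Q)\<^sub>s\<close>, and the sums over \<open>A\<close> and \<open>B\<close> are again instances of Euler's identity, now in base \<open>Q\<^sup>2 = q\<^sup>4\<close>.
\<close>

section \<open>Finite q-Pochhammer symbols: product rules, nonvanishing and growth bounds\<close>

lemma qpoch_0 [simp]: "qpoch a q 0 = 1"
  by (simp add: qpoch_def)

lemma qpoch_Suc: "qpoch a q (Suc n) = qpoch a q n * (1 - a * q ^ n)"
  by (simp add: qpoch_def)

lemma qpoch_Suc_left: "qpoch a q (Suc n) = (1 - a) * qpoch (a * q) q n"
  by (simp add: qpoch_def prod.lessThan_Suc_shift mult.assoc del: prod.lessThan_Suc)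

text \<open>The factors pair up as \<open>(1 - p^(i+1)) (1 + p^(i+1))\<close>. This is the bridge
  between the bases \<open>p\<close> and \<open>p^2\<close>.\<close>

lemma qpoch_mult_uminus:
  "qpoch p p n * qpoch (- p) p n = qpoch (p\<^sup>2) (p\<^sup>2) n"
  by (simp add: qpoch_def prod.distrib[symmetric] power2_eq_square power_mult_distrib algebra_simps)

lemma power_neq_1_of_norm_less_1:
  fixes q :: complex
  assumes "norm q < 1" "n > 0"
  shows "q ^ n \<noteq> 1"
proof
  assume "q ^ n = 1"
  then have "norm q ^ n = 1"
    by (metis norm_one norm_power)
  moreover have "norm q ^ n < 1"
    using assms by (simp add: power_less_one_iff)
  ultimately show False by simp
qed

lemma one_minus_power_neq_0:
  fixes q :: complex
  assumes "norm q < 1"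
  shows "1 - q * q ^ n \<noteq> 0"
  using power_neq_1_of_norm_less_1[OF assms, of "Suc n"] by auto

lemma one_minus_norm_le:
  fixes q :: complex
  assumes "norm q < 1"
  shows "1 - norm q \<le> norm (1 - q * q ^ n)"
proof -
  have "norm q * norm q ^ n \<le> norm q * 1"
    using assms by (intro mult_left_mono power_le_one) auto
  then show ?thesis
    using norm_triangle_ineq2[of 1 "q * q ^ n"] by (simp add: norm_mult norm_power)
qed

lemma qpoch_self_neq_0:
  assumes "norm q < 1"
  shows "qpoch q q n \<noteq> 0"
  using one_minus_power_neq_0[OF assms] by (simp add: qpoch_def)

lemma one_plus_power_neq_0:
  fixes q :: complex
  assumes "norm q < 1"
  shows "1 + q * q ^ n \<noteq> 0"
proof
  assume "1 + q * q ^ n = 0"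
  then have "q ^ Suc n = -1"
    by (metis add.inverse_unique power_Suc)
  then have "norm q ^ Suc n = 1"
    by (metis norm_minus_cancel norm_one norm_power)
  moreover have "norm q ^ Suc n < 1"
    using assms by (subst power_less_one_iff) auto
  ultimately show False by simp
qed

text \<open>A crude geometric bound is enough: together with the next one it only has to give the
  generating functions a positive radius of convergence.\<close>

lemma norm_qpoch_le:
  assumes "norm q < 1"
  shows "norm (qpoch a q n) \<le> (1 + norm a) ^ n"
proof (induction n)
  case (Suc n)
  have "norm (1 - a * q ^ n) \<le> 1 + norm a * norm q ^ n"
    by (metis norm_mult norm_one norm_power norm_triangle_ineq4)
  also have "\<dots> \<le> 1 + norm a * 1"
    using assms by (intro add_left_mono mult_left_mono power_le_one) auto
  finally show ?case
    using Suc by (simp add: qpoch_Suc norm_mult mult.commute[of "1 + norm a"] mult_mono)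
qed auto

lemma norm_inverse_qpoch_self_le:
  assumes "norm q < 1"
  shows "norm (inverse (qpoch q q n)) \<le> (1 / (1 - norm q)) ^ n"
proof (induction n)
  case (Suc n)
  have "norm (inverse (1 - q * q ^ n)) \<le> 1 / (1 - norm q)"
    using assms one_minus_norm_le[OF assms] by (simp add: norm_divide inverse_eq_divide frac_le)
  then have "norm (inverse (qpoch q q n)) * norm (inverse (1 - q * q ^ n))
      \<le> (1 / (1 - norm q)) ^ n * (1 / (1 - norm q))"
    using Suc assms by (intro mult_mono zero_le_power) auto
  then show ?case
    by (simp add: qpoch_Suc norm_mult inverse_mult_distrib mult.commute)
qed auto

section \<open>Dilation of formal power series and first-order q-difference equations\<close>

text \<open>The substitution of \<open>p z\<close> for \<open>z\<close>, phrased as a composition so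
  that multiplicativity is inherited from \<open>fps_compose\<close>.\<close>

definition fps_dilate :: "complex \<Rightarrow> complex fps \<Rightarrow> complex fps" where
  "fps_dilate p f = fps_compose f (fps_const p * fps_X)"

lemma fps_dilate_nth [simp]: "fps_nth (fps_dilate p f) n = p ^ n * fps_nth f n"
  by (simp add: fps_dilate_def)

lemma fps_dilate_mult: "fps_dilate p (f * g) = fps_dilate p f * fps_dilate p g"
  by (simp add: fps_dilate_def fps_compose_mult_distrib)

lemma fps_dilate_diff: "fps_dilate p (f - g) = fps_dilate p f - fps_dilate p g"
  by (simp add: fps_eq_iff algebra_simps)

lemma fps_mult_nth_of_vanishing:
  fixes f g :: "'a :: comm_ring_1 fps"
  assumes "\<And>i. i < n \<Longrightarrow> fps_nth g i = 0"
  shows "fps_nth (f * g) n = fps_nth f 0 * fps_nth g n"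
proof -
  have "fps_nth (f * g) n = (\<Sum>i\<in>{0..n}. fps_nth f i * fps_nth g (n - i))"
    by (simp add: fps_mult_nth)
  also have "\<dots> = (\<Sum>i\<in>{0}. fps_nth f i * fps_nth g (n - i))"
    using assms by (intro sum.mono_neutral_right) auto
  finally show ?thesis by simp
qed

text \<open>All product identities for formal \<open>q\<close>-series are obtained by comparing the two sides of
  a first-order \<open>q\<close>-difference equation.\<close>

lemma fps_dilate_equation_unique:
  assumes p: "norm p < 1" and vw: "fps_nth v 0 = 1" "fps_nth w 0 = 1"
    and f: "v * fps_dilate p f = w * f" and g: "v * fps_dilate p g = w * g"
    and 0: "fps_nth f 0 = fps_nth g 0"
  shows "f = g"
proof -
  \<comment> \<open>The equation is linear, so \<open>h\<close> satisfies it too. If all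
    coefficients of \<open>h\<close> below degree \<open>n > 0\<close> vanish, comparing degree
    \<open>n\<close> gives \<open>p^n h_n = h_n\<close>, and \<open>p^n\<close> is not 1.\<close>
  define h where "h = f - g"
  have eq: "v * fps_dilate p h = w * h"
    using f g by (simp add: h_def fps_dilate_diff algebra_simps)
  have "fps_nth h n = 0" for n
  proof (induction n rule: less_induct)
    case (less n)
    show ?case
    proof (cases "n = 0")
      case True
      then show ?thesis using 0 by (simp add: h_def)
    next
      case False
      have "fps_nth (v * fps_dilate p h) n = p ^ n * fps_nth h n"
        using less vw by (subst fps_mult_nth_of_vanishing) auto
      moreover have "fps_nth (w * h) n = fps_nth h n"
        using less vw by (subst fps_mult_nth_of_vanishing) auto
      ultimately have "(p ^ n - 1) * fps_nth h n = 0"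
        using eq by (simp add: algebra_simps)
      then show ?thesis
        using power_neq_1_of_norm_less_1[OF p, of n] False by simp
    qed
  qed
  then show ?thesis
    by (simp add: h_def fps_eq_iff)
qed

text \<open>As power series in \<open>z\<close>, \<open>fps_qexp p c\<close> is \<open>1 / (c z; p)\<^sub>\<infinity>\<close> and
  \<open>fps_qExp p c\<close> is \<open>(- c z; p)\<^sub>\<infinity>\<close>.\<close>

definition fps_qexp :: "complex \<Rightarrow> complex \<Rightarrow> complex fps" where
  "fps_qexp p c = Abs_fps (\<lambda>n. c ^ n / qpoch p p n)"

definition fps_qExp :: "complex \<Rightarrow> complex \<Rightarrow> complex fps" where
  "fps_qExp p c = Abs_fps (\<lambda>n. c ^ n * p ^ (n choose 2) / qpoch p p n)"

lemma fps_nth_one_plus_const_X_mult: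
  fixes f :: "'a :: comm_ring_1 fps"
  shows "fps_nth ((1 + fps_const c * fps_X) * f) n
    = fps_nth f n + (if n = 0 then 0 else c * fps_nth f (n - 1))"
  by (simp add: distrib_right mult.assoc)

lemma fps_nth_one_minus_const_X_mult:
  fixes f :: "'a :: comm_ring_1 fps"
  shows "fps_nth ((1 - fps_const c * fps_X) * f) n
    = fps_nth f n - (if n = 0 then 0 else c * fps_nth f (n - 1))"
  by (simp add: left_diff_distrib mult.assoc)

lemma fps_dilate_one_minus:
  "fps_dilate p (1 - fps_const c * fps_X) = 1 - fps_const (p * c) * fps_X"
  by (rule fps_ext) (auto simp: le_Suc_eq)

text \<open>Passing from \<open>z\<close> to \<open>p z\<close> removes the first factor
  \<open>1 - c z\<close> from the product \<open>(c z; p)_inf\<close> in the denominator.\<close>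

lemma fps_dilate_qexp:
  assumes "norm p < 1"
  shows "fps_dilate p (fps_qexp p c) = (1 - fps_const c * fps_X) * fps_qexp p c"
proof (rule fps_ext)
  fix n
  show "fps_nth (fps_dilate p (fps_qexp p c)) n
      = fps_nth ((1 - fps_const c * fps_X) * fps_qexp p c) n"
  proof (cases n)
    case (Suc m)
    then show ?thesis
      using qpoch_self_neq_0[OF assms, of m] one_minus_power_neq_0[OF assms, of m]
      by (simp add: fps_nth_one_minus_const_X_mult fps_qexp_def qpoch_Suc divide_simps)
        (simp add: algebra_simps)
  qed (simp add: fps_qexp_def fps_nth_one_minus_const_X_mult)
qed

lemma Suc_choose_two: "Suc n choose 2 = n + (n choose 2)"
  by (simp add: numeral_2_eq_2)

text \<open>Lets exponents with binomial coefficients be compared by ring arithmetic on natural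
  numbers, without division.\<close>

lemma two_mult_choose_two: "2 * (n choose 2) + n = n * n"
  by (induction n) (auto simp: Suc_choose_two binomial_eq_0)

text \<open>Passing from \<open>z\<close> to \<open>p z\<close> removes the first factor
  \<open>1 + c z\<close> from the product \<open>(- c z; p)_inf\<close>.\<close>

lemma fps_dilate_qExp:
  assumes "norm p < 1"
  shows "(1 + fps_const c * fps_X) * fps_dilate p (fps_qExp p c) = fps_qExp p c"
proof (rule fps_ext)
  fix n
  show "fps_nth ((1 + fps_const c * fps_X) * fps_dilate p (fps_qExp p c)) n
      = fps_nth (fps_qExp p c) n"
  proof (cases n)
    case (Suc m)
    then show ?thesis
      using qpoch_self_neq_0[OF assms, of m] one_minus_power_neq_0[OF assms, of m]
      by (simp add: fps_nth_one_plus_const_X_mult fps_qExp_def qpoch_Suc divide_simps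
            Suc_choose_two power_add)
        (simp add: algebra_simps)
  qed (simp add: fps_qExp_def fps_nth_one_plus_const_X_mult)
qed

section \<open>Product identities between formal q-series\<close>

text \<open>The q-binomial theorem: both sides solve
  \<open>(1 - y c z) f(p z) = (1 - c z) f(z)\<close> with constant term 1.\<close>

lemma fps_q_binomial:
  assumes "norm p < 1"
  shows "Abs_fps (\<lambda>n. qpoch y p n * c ^ n / qpoch p p n)
    = fps_qExp p (- (y * c)) * fps_qexp p c" (is "?f = ?g")
proof (rule fps_dilate_equation_unique[OF assms])
  let ?v = "1 + fps_const (- (y * c)) * fps_X" and ?w = "1 - fps_const c * fps_X"
  show "fps_nth ?v 0 = 1" "fps_nth ?w 0 = 1" by simp_all
  show "?v * fps_dilate p ?f = ?w * ?f"
  proof (rule fps_ext)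
    fix n
    show "fps_nth (?v * fps_dilate p ?f) n = fps_nth (?w * ?f) n"
    proof (cases n)
      case (Suc m)
      then show ?thesis
        using qpoch_self_neq_0[OF assms, of m] one_minus_power_neq_0[OF assms, of m]
        unfolding fps_nth_one_plus_const_X_mult fps_nth_one_minus_const_X_mult
        by (simp add: qpoch_Suc divide_simps) (simp add: algebra_simps)
    qed (simp add: fps_nth_one_plus_const_X_mult fps_nth_one_minus_const_X_mult)
  qed
  show "?v * fps_dilate p ?g = ?w * ?g"
  proof -
    have "?v * fps_dilate p ?g
        = (?v * fps_dilate p (fps_qExp p (- (y * c)))) * fps_dilate p (fps_qexp p c)"
      by (simp only: fps_dilate_mult mult.assoc)
    also have "\<dots> = ?w * ?g"
      unfolding fps_dilate_qExp[OF assms] fps_dilate_qexp[OF assms] by (simp only: mult_ac)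
    finally show ?thesis .
  qed
  show "fps_nth ?f 0 = fps_nth ?g 0"
    by (simp add: fps_qExp_def fps_qexp_def binomial_eq_0)
qed

text \<open>The factors \<open>1 - z q^i\<close> of \<open>(z; q)_inf\<close> are separated by the
  parity of \<open>i\<close>; both sides solve
  \<open>f(q^2 z) = (1 - z) (1 - q z) f(z)\<close>.\<close>

lemma fps_qexp_split_base:
  assumes "norm q < 1"
  shows "fps_qexp q 1 = fps_qexp (q\<^sup>2) 1 * fps_qexp (q\<^sup>2) q"
proof (rule fps_dilate_equation_unique)
  let ?w = "(1 - fps_const 1 * fps_X) * (1 - fps_const q * fps_X)"
  have q2: "norm (q\<^sup>2) < 1"
    using assms by (simp add: norm_power power_less_one_iff)
  show "norm (q\<^sup>2) < 1" by fact
  show "fps_nth 1 0 = 1" "fps_nth ?w 0 = 1" by simp_all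
  have "fps_dilate (q\<^sup>2) (fps_qexp q 1) = fps_dilate q (fps_dilate q (fps_qexp q 1))"
    by (rule fps_ext) (simp add: power2_eq_square power_mult_distrib)
  also have "\<dots> = ?w * fps_qexp q 1"
    by (simp only: fps_dilate_qexp[OF assms] fps_dilate_mult fps_dilate_one_minus)
      (simp add: mult_ac)
  finally show "1 * fps_dilate (q\<^sup>2) (fps_qexp q 1) = ?w * fps_qexp q 1" by simp
  show "1 * fps_dilate (q\<^sup>2) (fps_qexp (q\<^sup>2) 1 * fps_qexp (q\<^sup>2) q)
      = ?w * (fps_qexp (q\<^sup>2) 1 * fps_qexp (q\<^sup>2) q)"
    by (simp only: fps_dilate_mult fps_dilate_qexp[OF q2]) (simp add: mult_ac)
  show "fps_nth (fps_qexp q 1) 0 = fps_nth (fps_qexp (q\<^sup>2) 1 * fps_qexp (q\<^sup>2) q) 0"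
    by (simp add: fps_qexp_def)
qed

text \<open>Since \<open>(c z; p)_inf (- c z; p)_inf = (c^2 z^2; p^2)_inf\<close>, the product is
  Euler's series in base \<open>p^2\<close> with argument \<open>c^2 z^2\<close>, so only even
  powers of \<open>z\<close> occur.\<close>

lemma fps_qexp_mult_uminus:
  assumes "norm p < 1"
  shows "fps_qexp p c * fps_qexp p (- c)
    = Abs_fps (\<lambda>n. if even n then c ^ n / qpoch (p\<^sup>2) (p\<^sup>2) (n div 2) else 0)" (is "?f = ?g")
proof (rule fps_dilate_equation_unique[OF assms])
  let ?w = "1 - fps_const (c\<^sup>2) * fps_X ^ 2"
  show "fps_nth 1 0 = 1" "fps_nth ?w 0 = 1" by simp_all
  have "(1 - fps_const c * fps_X) * (1 - fps_const (- c) * fps_X) = ?w"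
    by (simp add: algebra_simps power2_eq_square flip: fps_const_mult fps_const_neg)
  then show "1 * fps_dilate p ?f = ?w * ?f"
    unfolding fps_dilate_mult fps_dilate_qexp[OF assms] by (simp add: ac_simps flip: \<open>_ = ?w\<close>)
  have p2: "norm (p\<^sup>2) < 1"
    using assms by (simp add: norm_power power_less_one_iff)
  show "1 * fps_dilate p ?g = ?w * ?g"
  proof (rule fps_ext)
    fix n
    have w: "fps_nth (?w * ?g) n
        = fps_nth ?g n - (if n < 2 then 0 else c\<^sup>2 * fps_nth ?g (n - 2))"
      by (simp only: left_diff_distrib mult.assoc fps_sub_nth fps_mult_left_const_nth
            fps_X_power_mult_nth mult_1) auto
    show "fps_nth (1 * fps_dilate p ?g) n = fps_nth (?w * ?g) n"
    proof (cases "even n \<and> n \<noteq> 0")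
      case True
      then obtain m where m: "n = Suc (Suc (2 * m))"
        by (metis evenE mult_Suc_right add_2_eq_Suc not0_implies_Suc mult_0_right)
      have "p * (p * p ^ (2 * m)) = p\<^sup>2 * (p\<^sup>2) ^ m"
        by (simp add: power_mult power2_eq_square)
      then show ?thesis
        using qpoch_self_neq_0[OF p2, of m] one_minus_power_neq_0[OF p2, of m]
        unfolding w using m
        by (simp add: qpoch_Suc divide_simps) (simp add: algebra_simps power2_eq_square)
    next
      case False
      then show ?thesis unfolding w by auto
    qed
  qed
  show "fps_nth ?f 0 = fps_nth ?g 0"
    by (simp add: fps_qexp_def)
qed

section \<open>The q-Vandermonde sum\<close>

text \<open>Induction on \<open>A\<close>, with \<open>B\<close> and \<open>y\<close> arbitrary
  because the recurrence shifts \<open>y\<close> to \<open>y Q\<close>; this is why \<open>y\<close>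
  is a parameter although the application has \<open>y = -1\<close>. The assumption on
  \<open>y\<close> keeps all denominators nonzero.\<close>

lemma q_vandermonde:
  fixes Q y :: complex
  assumes Q: "norm Q < 1" and y: "\<And>i. y * Q * Q ^ i \<noteq> 1"
  shows "(\<Sum>i\<le>min A B. Q ^ ((A - i) * (B - i))
            / (qpoch Q Q (A - i) * qpoch Q Q (B - i) * qpoch Q Q i * qpoch (y * Q) Q i))
    = qpoch (y * Q) Q (A + B) / (qpoch Q Q A * qpoch Q Q B * qpoch (y * Q) Q A * qpoch (y * Q) Q B)"
  using y
proof (induction A arbitrary: B y)
  case 0
  have "qpoch (y * Q) Q B \<noteq> 0"
    using 0 by (auto simp: qpoch_def)
  then show ?case by simp
next
  case (Suc A)
  have nz: "qpoch Q Q n \<noteq> 0" for n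
    by (rule qpoch_self_neq_0[OF Q])
  have nz': "qpoch (y * Q) Q n \<noteq> 0" for n
    using Suc.prems by (auto simp: qpoch_def)
  have nz1: "1 - Q * Q ^ n \<noteq> 0" for n
    by (rule one_minus_power_neq_0[OF Q])
  have nz2: "1 - y * Q * Q ^ n \<noteq> 0" for n
    using Suc.prems by simp
  define T where "T y A B i = Q ^ ((A - i) * (B - i))
            / (qpoch Q Q (A - i) * qpoch Q Q (B - i) * qpoch Q Q i * qpoch (y * Q) Q i)" for y A B i
  define R where "R y A B = qpoch (y * Q) Q (A + B)
      / (qpoch Q Q A * qpoch Q Q B * qpoch (y * Q) Q A * qpoch (y * Q) Q B)" for y A B
  have IH: "(\<Sum>i\<le>min A B. T y A B i) = R y A B" for B
    using Suc.IH[OF Suc.prems] by (simp add: T_def R_def)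
  txt \<open>The \<open>q\<close>-Pascal splitting of \<open>1 - Q\<^bsup>A+1\<^esup>\<close> reduces the sum for \<open>(y, A + 1, B)\<close> to those for
    \<open>(y, A, B)\<close> and \<open>(y Q, A, B - 1)\<close>.\<close>
  have split: "(1 - Q * Q ^ A) * T y (Suc A) B i
      = Q ^ i * (1 - Q ^ (Suc A - i)) * T y (Suc A) B i + (1 - Q ^ i) * T y (Suc A) B i"
    if "i \<le> Suc A" for i
  proof -
    have "Q * Q ^ A = Q ^ i * Q ^ (Suc A - i)"
      using that by (simp flip: power_add power_Suc)
    then show ?thesis by (simp add: algebra_simps)
  qed
  have first: "(\<Sum>i\<le>min (Suc A) B. Q ^ i * (1 - Q ^ (Suc A - i)) * T y (Suc A) B i)
      = Q ^ B * R y A B"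
  proof -
    \<comment> \<open>The only index that can be lost is \<open>i = Suc A\<close>, where the factor
      \<open>1 - Q^0\<close> vanishes.\<close>
    have "(\<Sum>i\<le>min (Suc A) B. Q ^ i * (1 - Q ^ (Suc A - i)) * T y (Suc A) B i)
        = (\<Sum>i\<le>min A B. Q ^ i * (1 - Q ^ (Suc A - i)) * T y (Suc A) B i)"
      by (rule sum.mono_neutral_right) (auto simp: not_le less_Suc_eq_le)
    also have "\<dots> = (\<Sum>i\<le>min A B. Q ^ B * T y A B i)"
    proof (rule sum.cong[OF refl])
      fix i assume "i \<in> {..min A B}"
      then have i: "i \<le> A" "i \<le> B" by auto
      have "Q ^ ((Suc A - i) * (B - i)) * Q ^ i = Q ^ B * Q ^ ((A - i) * (B - i))"
        using i by (simp add: Suc_diff_le flip: power_add)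
      then show "Q ^ i * (1 - Q ^ (Suc A - i)) * T y (Suc A) B i = Q ^ B * T y A B i"
        using i nz nz' nz1 by (simp add: T_def Suc_diff_le qpoch_Suc divide_simps)
          (simp add: mult_ac)
    qed
    finally show ?thesis by (simp add: IH flip: sum_distrib_left)
  qed
  \<comment> \<open>The term \<open>i = 0\<close> vanishes. Shifting \<open>i\<close> by one and
    splitting off the first factor \<open>1 - y Q\<close> of \<open>qpoch (y * Q) Q (Suc i)\<close>
    replaces \<open>y\<close> by \<open>y Q\<close>. For \<open>B = 0\<close> nothing
    remains.\<close>
  have second: "(\<Sum>i\<le>min (Suc A) B. (1 - Q ^ i) * T y (Suc A) B i)
      = (if B = 0 then 0 else R (y * Q) A (B - 1) / (1 - y * Q))"
  proof (cases B)
    case (Suc B')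
    have "(\<Sum>i\<le>min (Suc A) B. (1 - Q ^ i) * T y (Suc A) B i)
        = (\<Sum>i\<le>min A B'. (1 - Q ^ Suc i) * T y (Suc A) B (Suc i))"
      unfolding Suc min_Suc_Suc by (subst sum.atMost_Suc_shift) simp
    also have "\<dots> = (\<Sum>i\<le>min A B'. T (y * Q) A B' i / (1 - y * Q))"
      using nz1 nz nz'
      by (intro sum.cong refl) (simp add: T_def Suc qpoch_Suc[of Q] qpoch_Suc_left[of "y * Q"])
    also have "\<dots> = R (y * Q) A B' / (1 - y * Q)"
    proof -
      have "(y * Q) * Q * Q ^ i \<noteq> 1" for i
        using Suc.prems[of "Suc i"] by (simp add: mult_ac)
      from Suc.IH[OF this] have "(\<Sum>i\<le>min A B'. T (y * Q) A B' i) = R (y * Q) A B'"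
        unfolding T_def R_def .
      then show ?thesis
        by (simp flip: sum_divide_distrib)
    qed
    finally show ?thesis using Suc by simp
  qed auto
  have "(1 - Q * Q ^ A) * (\<Sum>i\<le>min (Suc A) B. T y (Suc A) B i)
      = Q ^ B * R y A B + (if B = 0 then 0 else R (y * Q) A (B - 1) / (1 - y * Q))"
    unfolding first[symmetric] second[symmetric] sum.distrib[symmetric] sum_distrib_left
    by (intro sum.cong refl split) auto
  \<comment> \<open>It remains to check that the closed form obeys the same recurrence.\<close>
  also have "\<dots> = (1 - Q * Q ^ A) * R y (Suc A) B"
  proof (cases B)
    case 0
    then show ?thesis
      using nz[of A] nz1[of A] nz'[of A] nz2[of A] by (simp add: R_def qpoch_Suc divide_simps)
  next
    case (Suc B')
    have yq: "1 - y * Q \<noteq> 0" using nz2[of 0] by simp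
    have *: "qpoch (y * Q * Q) Q n = qpoch (y * Q) Q (Suc n) / (1 - y * Q)" for n
      using yq by (simp add: qpoch_Suc_left[of "y * Q"])
    have "qpoch (y * Q) Q (Suc (A + B')) \<noteq> 0" by (rule nz')
    then show ?thesis
      using nz[of A] nz[of B'] nz1[of A] nz1[of B'] nz'[of A] nz'[of B'] nz2[of A] nz2[of B'] yq
        nz'[of "A + B'"]
      unfolding R_def Suc *
      by (simp add: qpoch_Suc divide_simps) (simp add: algebra_simps power_add)
  qed
  finally have "(\<Sum>i\<le>min (Suc A) B. T y (Suc A) B i) = R y (Suc A) B"
    using nz1[of A] by (simp only: mult_cancel_left) simp
  then show ?case
    unfolding T_def R_def .
qed

section \<open>Convergence and Euler's identities for infinite products\<close>

lemma norm_qExp_Suc_le: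
  assumes "norm p < 1"
  shows "norm (fps_nth (fps_qExp p y) (Suc n))
    \<le> norm p ^ n * (norm y / (1 - norm p)) * norm (fps_nth (fps_qExp p y) n)"
proof -
  have "norm y / norm (1 - p * p ^ n) \<le> norm y / (1 - norm p)"
    using one_minus_norm_le[OF assms] one_minus_power_neq_0[OF assms] assms
    by (intro divide_left_mono mult_pos_pos) auto
  then have "norm p ^ n * (norm y / norm (1 - p * p ^ n)) * norm (fps_nth (fps_qExp p y) n)
      \<le> norm p ^ n * (norm y / (1 - norm p)) * norm (fps_nth (fps_qExp p y) n)"
    by (intro mult_right_mono mult_left_mono) auto
  then show ?thesis
    by (simp add: fps_qExp_def qpoch_Suc Suc_choose_two power_add norm_mult norm_divide norm_power
        mult_ac)
qed

text \<open>The factor \<open>p^n\<close> makes the ratio of consecutive terms tend to 0, so the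
  series converges absolutely for every \<open>y\<close>.\<close>

lemma summable_norm_qExp:
  assumes "norm p < 1"
  shows "summable (\<lambda>n. norm (fps_nth (fps_qExp p y) n))"
proof -
  have "(\<lambda>n. norm p ^ n * (norm y / (1 - norm p))) \<longlonglongrightarrow> 0 * (norm y / (1 - norm p))"
    using assms by (intro tendsto_mult tendsto_const LIMSEQ_power_zero) auto
  then have "\<forall>\<^sub>F n in sequentially. norm p ^ n * (norm y / (1 - norm p)) < 1 / 2"
    by (rule order_tendstoD) auto
  then obtain N where N: "\<And>n. n \<ge> N \<Longrightarrow> norm p ^ n * (norm y / (1 - norm p)) < 1 / 2"
    by (auto simp: eventually_sequentially)
  show ?thesis
  proof (rule summable_ratio_test[of "1 / 2" N])
    fix n assume "N \<le> n"
    then have "norm p ^ n * (norm y / (1 - norm p)) * norm (fps_nth (fps_qExp p y) n)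
        \<le> 1 / 2 * norm (fps_nth (fps_qExp p y) n)"
      using N[of n] by (intro mult_right_mono) auto
    then show "norm (norm (fps_nth (fps_qExp p y) (Suc n)))
        \<le> 1 / 2 * norm (norm (fps_nth (fps_qExp p y) n))"
      by (simp only: norm_ge_zero abs_of_nonneg real_norm_def)
        (rule order_trans[OF norm_qExp_Suc_le[OF assms]])
  qed auto
qed

lemma qpoch_tendsto_qpoch_inf:
  assumes "norm p < 1"
  shows "(\<lambda>n. qpoch a p n) \<longlonglongrightarrow> qpoch_inf a p"
  unfolding qpoch_def qpoch_inf_def
  by (rule has_prod_imp_tendsto')
    (rule convergent_prod_has_prod[OF convergent_prod_qpoch_inf[OF assms]])

text \<open>Euler's identity. The sum \<open>F\<close> satisfies
  \<open>F y = (1 + y) F (p y)\<close>; iterating produces the partial products of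
  \<open>(- y; p)_inf\<close>, and the remaining factor \<open>F (y p^n)\<close> tends to
  \<open>F 0 = 1\<close> by continuity.\<close>

lemma qExp_has_sum:
  assumes p: "norm p < 1"
  shows "(fps_nth (fps_qExp p y) has_sum qpoch_inf (- y) p) UNIV"
proof -
  define F where "F y = (\<Sum>n. fps_nth (fps_qExp p y) n)" for y
  have F_sums: "fps_nth (fps_qExp p y) sums F y" for y
    unfolding F_def by (intro summable_sums summable_norm_cancel[OF summable_norm_qExp[OF p]])
  have step: "F y = (1 + y) * F (p * y)" for y
  proof -
    have nth: "fps_nth (fps_qExp p (p * y)) = fps_nth (fps_dilate p (fps_qExp p y))"
      by (rule ext) (simp add: fps_qExp_def power_mult_distrib)
    have "(\<lambda>n. if n = 0 then 0 else y * fps_nth (fps_qExp p (p * y)) (n - 1)) sums (y * F (p * y))"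
      using sums_Suc[of "\<lambda>n. if n = 0 then 0 else y * fps_nth (fps_qExp p (p * y)) (n - 1)"]
        sums_mult[OF F_sums] by simp
    from sums_add[OF F_sums[of "p * y"] this]
    have "(\<lambda>n. fps_nth (fps_qExp p y) n) sums (F (p * y) + y * F (p * y))"
      unfolding nth by (simp only: fps_nth_one_plus_const_X_mult[symmetric] fps_dilate_qExp[OF p])
    with F_sums show ?thesis
      by (metis sums_unique2 distrib_right mult_1)
  qed
  have iter: "F y = qpoch (- y) p n * F (y * p ^ n)" for n
  proof (induction n)
    case (Suc n)
    then show ?case
      using step[of "y * p ^ n"] by (simp add: qpoch_Suc mult_ac)
  qed simp
  have nth_eq: "fps_nth (fps_qExp p z) = (\<lambda>n. (p ^ (n choose 2) / qpoch p p n) * z ^ n)" for z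
    by (rule ext) (simp add: fps_qExp_def mult_ac)
  have F_eq: "F = (\<lambda>y. \<Sum>n. (p ^ (n choose 2) / qpoch p p n) * y ^ n)"
    by (rule ext) (simp add: F_def nth_eq)
  have "isCont F 0"
    unfolding F_eq
  proof (rule isCont_powser_converges_everywhere)
    show "summable (\<lambda>n. p ^ (n choose 2) / qpoch p p n * z ^ n)" for z
      using sums_summable[OF F_sums[of z]] unfolding nth_eq .
  qed
  moreover have "(\<lambda>n. y * p ^ n) \<longlonglongrightarrow> 0"
    using tendsto_mult_right_zero[OF LIMSEQ_power_zero[OF p]] by simp
  ultimately have "(\<lambda>n. F (y * p ^ n)) \<longlonglongrightarrow> F 0"
    by (rule isCont_tendsto_compose)
  moreover have "F 0 = 1"
    unfolding F_eq powser_zero by (simp add: binomial_eq_0)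
  ultimately have "(\<lambda>n. qpoch (- y) p n * F (y * p ^ n)) \<longlonglongrightarrow> qpoch_inf (- y) p * 1"
    by (intro tendsto_mult qpoch_tendsto_qpoch_inf p) simp
  then have "F y = qpoch_inf (- y) p"
    by (simp add: iter[symmetric] LIMSEQ_const_iff)
  with norm_summable_imp_has_sum[OF summable_norm_qExp[OF p] F_sums[of y]] show ?thesis
    by simp
qed

text \<open>Even and odd factors give \<open>(p; p)_inf = (p; p^2)_inf (p^2; p^2)_inf\<close>, while
  \<open>(- p; p)_inf (p; p)_inf = (p^2; p^2)_inf\<close>. Combining them allows the nonzero
  \<open>(p^2; p^2)_inf\<close> to be cancelled.\<close>

lemma qpoch_inf_uminus_mult:
  assumes p: "norm p < 1"
  shows "qpoch_inf (- p) p * qpoch_inf p (p\<^sup>2) = 1"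
proof -
  have p2: "norm (p\<^sup>2) < 1"
    using p by (simp add: norm_power power_less_one_iff)
  have even_odd: "qpoch p p (2 * n) = qpoch p (p\<^sup>2) n * qpoch (p\<^sup>2) (p\<^sup>2) n" for n
    by (induction n) (simp_all add: qpoch_Suc power_mult power_mult_distrib power2_eq_square mult_ac)
  have "filterlim (\<lambda>n::nat. 2 * n) sequentially sequentially"
    by (rule filterlim_subseq) (simp add: strict_mono_def)
  with qpoch_tendsto_qpoch_inf[OF p] have "(\<lambda>n. qpoch p p (2 * n)) \<longlonglongrightarrow> qpoch_inf p p"
    by (rule filterlim_compose)
  then have 1: "qpoch_inf p p = qpoch_inf p (p\<^sup>2) * qpoch_inf (p\<^sup>2) (p\<^sup>2)"
    unfolding even_odd
    by (rule LIMSEQ_unique) (intro tendsto_mult qpoch_tendsto_qpoch_inf p2)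
  have "(\<lambda>n. qpoch (p\<^sup>2) (p\<^sup>2) n) \<longlonglongrightarrow> qpoch_inf (- p) p * qpoch_inf p p"
    unfolding qpoch_mult_uminus[symmetric] mult.commute[of "qpoch p p _"]
    by (intro tendsto_mult qpoch_tendsto_qpoch_inf p)
  then have 2: "qpoch_inf (- p) p * qpoch_inf p p = qpoch_inf (p\<^sup>2) (p\<^sup>2)"
    by (rule LIMSEQ_unique) (rule qpoch_tendsto_qpoch_inf[OF p2])
  have "qpoch_inf (p\<^sup>2) (p\<^sup>2) \<noteq> 0"
    unfolding qpoch_inf_def using one_minus_power_neq_0[OF p2]
    by (intro prodinf_nonzero convergent_prod_qpoch_inf p2) auto
  with 1 2 show ?thesis by simp
qed

section \<open>Weighted sums over graded families\<close>

text \<open>\<open>f\<close> is the generating function of the weighted family \<open>c\<close> graded by \<open>d\<close>, with positive radius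
  of convergence; a rapidly decaying weight may then be inserted at each degree.\<close>

definition enumerates :: "('a \<Rightarrow> nat) \<Rightarrow> ('a \<Rightarrow> complex) \<Rightarrow> complex fps \<Rightarrow> bool" where
  "enumerates d c f \<longleftrightarrow> (\<exists>r>0. r < 1 \<and> (\<lambda>a. norm (c a) * r ^ d a) summable_on UNIV)
    \<and> (\<forall>n. finite {a. d a = n} \<and> fps_nth f n = sum c {a. d a = n})"

lemma enumerates_inj:
  assumes "inj d" and bound: "\<And>a. norm (c a) \<le> \<rho> ^ d a"
    and range: "\<And>a. fps_nth f (d a) = c a" "\<And>n. n \<notin> range d \<Longrightarrow> fps_nth f n = 0"
  shows "enumerates d c f"
proof -
  \<comment> \<open>Chosen so that \<open>\<bar>\<rho>\<bar> * r \<le> 1/2\<close> and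
    \<open>0 < r < 1\<close> hold for every real \<open>\<rho>\<close>; the bound then compares with
    a geometric series of ratio 1/2.\<close>
  define r where "r = 1 / (2 * (1 + \<bar>\<rho>\<bar>))"
  have r: "0 < r" "r < 1"
    by (auto simp: r_def divide_simps)
  have le: "\<bar>\<rho>\<bar> * r \<le> 1 / 2"
    by (auto simp: r_def divide_simps)
  have "(\<lambda>n. (1 / 2 :: real) ^ n) summable_on UNIV"
    using summable_geometric[of "1 / 2 :: real"] by (intro norm_summable_imp_summable_on) simp
  then have "(\<lambda>n. (1 / 2 :: real) ^ n) summable_on range d"
    by (rule summable_on_subset) auto
  then have half: "(\<lambda>a. (1 / 2 :: real) ^ d a) summable_on UNIV"
    using summable_on_reindex[OF \<open>inj d\<close>, of "\<lambda>n. (1 / 2 :: real) ^ n"] by (simp add: o_def)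
  have "(\<lambda>a. norm (c a) * r ^ d a) summable_on UNIV"
  proof (rule summable_on_comparison_test[OF half])
    fix a
    have "norm (c a) * r ^ d a \<le> \<bar>\<rho>\<bar> ^ d a * r ^ d a"
      using bound[of a] r by (intro mult_right_mono) (auto simp: power_abs[symmetric])
    also have "\<dots> \<le> (1 / 2) ^ d a"
      unfolding power_mult_distrib[symmetric] using le r by (intro power_mono) auto
    finally show "norm (c a) * r ^ d a \<le> (1 / 2) ^ d a" .
  qed (use r in auto)
  moreover have "finite {a. d a = n} \<and> fps_nth f n = sum c {a. d a = n}" for n
  proof (cases "n \<in> range d")
    case True
    then obtain a where a: "n = d a" by auto
    then have "{a. d a = n} = {a}"
      using \<open>inj d\<close> by (auto dest: injD)
    then show ?thesis using range a by simp
  next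
    case False
    then have "{a. d a = n} = {}" by auto
    then show ?thesis using range False by simp
  qed
  ultimately show ?thesis
    using r by (auto simp: enumerates_def)
qed

lemma summable_on_product_real:
  fixes f :: "'a \<Rightarrow> real" and g :: "'b \<Rightarrow> real"
  assumes "f summable_on UNIV" "g summable_on UNIV" "\<And>x. f x \<ge> 0" "\<And>y. g y \<ge> 0"
  shows "(\<lambda>(x, y). f x * g y) summable_on UNIV"
proof -
  have "(\<lambda>(x, y). f x * g y) summable_on Sigma UNIV (\<lambda>_. UNIV)"
  proof (rule summable_on_SigmaI)
    show "((\<lambda>y. case (x, y) of (x, y) \<Rightarrow> f x * g y) has_sum f x * infsum g UNIV) UNIV" for x
      using assms by (simp add: has_sum_cmult_right)
    show "(\<lambda>x. f x * infsum g UNIV) summable_on UNIV"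
      using assms by (intro summable_on_cmult_left)
  qed (use assms in auto)
  then show ?thesis by simp
qed

text \<open>The smaller of the two radii serves both families. The pairs of total degree
  \<open>n\<close> split into finitely many finite rectangles, which reproduces the Cauchy
  product.\<close>

lemma enumerates_mult:
  assumes "enumerates d1 c1 f1" "enumerates d2 c2 f2"
  shows "enumerates (\<lambda>(a, b). d1 a + d2 b) (\<lambda>(a, b). c1 a * c2 b) (f1 * f2)"
proof -
  obtain r1 where r1: "0 < r1" "r1 < 1" "(\<lambda>a. norm (c1 a) * r1 ^ d1 a) summable_on UNIV"
    using assms(1) by (auto simp: enumerates_def)
  obtain r2 where r2: "0 < r2" "r2 < 1" "(\<lambda>a. norm (c2 a) * r2 ^ d2 a) summable_on UNIV"
    using assms(2) by (auto simp: enumerates_def)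
  have fin: "finite {a. d1 a = n}" "finite {a. d2 a = n}"
    and nth: "fps_nth f1 n = sum c1 {a. d1 a = n}" "fps_nth f2 n = sum c2 {a. d2 a = n}" for n
    using assms by (auto simp: enumerates_def)
  define r where "r = min r1 r2"
  have r: "0 < r" "r < 1" "r \<le> r1" "r \<le> r2"
    using r1 r2 by (auto simp: r_def)
  have "(\<lambda>a. norm (c1 a) * r ^ d1 a) summable_on UNIV"
    by (rule summable_on_comparison_test[OF r1(3)]) (use r in \<open>auto intro!: mult_left_mono power_mono\<close>)
  moreover have "(\<lambda>a. norm (c2 a) * r ^ d2 a) summable_on UNIV"
    by (rule summable_on_comparison_test[OF r2(3)]) (use r in \<open>auto intro!: mult_left_mono power_mono\<close>)
  ultimately have "(\<lambda>(a, b). (norm (c1 a) * r ^ d1 a) * (norm (c2 b) * r ^ d2 b)) summable_on UNIV"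
    using r by (intro summable_on_product_real) auto
  then have sum: "(\<lambda>x. norm ((\<lambda>(a, b). c1 a * c2 b) x) * r ^ ((\<lambda>(a, b). d1 a + d2 b) x))
      summable_on UNIV"
    by (simp add: case_prod_unfold norm_mult power_add mult_ac)
  have fib: "{x. (\<lambda>(a, b). d1 a + d2 b) x = n} = (\<Union>i\<in>{0..n}. {a. d1 a = i} \<times> {b. d2 b = n - i})" for n
    by auto
  have "sum (\<lambda>(a, b). c1 a * c2 b) (\<Union>i\<in>{0..n}. {a. d1 a = i} \<times> {b. d2 b = n - i})
      = (\<Sum>i\<in>{0..n}. sum (\<lambda>(a, b). c1 a * c2 b) ({a. d1 a = i} \<times> {b. d2 b = n - i}))" for n
    using fin by (intro sum.UNION_disjoint) auto
  also have "\<dots> n = fps_nth (f1 * f2) n" for n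
    by (simp add: fps_mult_nth nth sum_product sum.cartesian_product)
  finally show ?thesis
    using r sum fin unfolding enumerates_def fib by (auto intro!: exI[of _ r])
qed

text \<open>Absolute convergence allows grouping by degree. The value depends on the family only
  through \<open>f\<close>, so two families with the same generating function have the same weighted
  sum; this is what carries formal identities over to the multiple sums.\<close>

lemma enumerates_weighted_has_sum:
  assumes "enumerates d c f" and w: "\<And>r :: real. 0 < r \<Longrightarrow> r < 1 \<Longrightarrow> \<exists>C. \<forall>n. norm (w n) \<le> C * r ^ n"
  shows "((\<lambda>a. w (d a) * c a) has_sum (\<Sum>\<^sub>\<infinity>n. w n * fps_nth f n)) UNIV"
proof -
  obtain r where r: "0 < r" "r < 1" "(\<lambda>a. norm (c a) * r ^ d a) summable_on UNIV"
    using assms(1) by (auto simp: enumerates_def)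
  obtain C where C: "norm (w n) \<le> C * r ^ n" for n
    using w[OF r(1,2)] by auto
  have "(\<lambda>a. norm (w (d a) * c a)) summable_on UNIV"
  proof (rule Infinite_Sum.abs_summable_on_comparison_test')
    show "(\<lambda>a. C * (norm (c a) * r ^ d a)) summable_on UNIV"
      by (intro summable_on_cmult_right r)
    show "norm (w (d a) * c a) \<le> C * (norm (c a) * r ^ d a)" for a
      using mult_right_mono[OF C[of "d a"], of "norm (c a)"] by (simp add: norm_mult mult_ac)
  qed
  then obtain S where S: "((\<lambda>a. w (d a) * c a) has_sum S) UNIV"
    using abs_summable_summable[of "\<lambda>a. w (d a) * c a" UNIV] by (auto simp: summable_on_def)
  moreover have "((\<lambda>(n, a). w (d a) * c a) has_sum S) (Sigma UNIV (\<lambda>n. {a. d a = n}))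
      \<longleftrightarrow> ((\<lambda>a. w (d a) * c a) has_sum S) UNIV"
    by (rule has_sum_reindex_bij_witness[where i = "\<lambda>a. (d a, a)" and j = snd]) auto
  ultimately have "((\<lambda>(n, a). w (d a) * c a) has_sum S) (Sigma UNIV (\<lambda>n. {a. d a = n}))"
    by simp
  then have "((\<lambda>n. w n * fps_nth f n) has_sum S) UNIV"
  proof (rule has_sum_SigmaD)
    show "((\<lambda>a. case (n, a) of (n, a) \<Rightarrow> w (d a) * c a) has_sum w n * fps_nth f n) {a. d a = n}" for n
      using assms(1) by (intro has_sum_finiteI) (auto simp: enumerates_def sum_distrib_left)
  qed
  with S show ?thesis by (simp add: infsumI)
qed

text \<open>From some \<open>N\<close> on \<open>norm q ^ n < r\<close>, and the \<open>n\<close>-th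
  power of this handles the exponent \<open>n^2\<close>; the constant \<open>1 / r^N\<close> absorbs
  the indices below \<open>N\<close>.\<close>

lemma norm_power_square_le_geometric:
  fixes q :: complex
  assumes "norm q < 1" "0 < r" "r < 1"
  shows "\<exists>C. \<forall>n. norm (q ^ (n\<^sup>2 + t * n)) \<le> C * r ^ n"
proof -
  have "(\<lambda>n. norm q ^ n) \<longlonglongrightarrow> 0"
    using assms by (intro LIMSEQ_power_zero) auto
  then have "\<forall>\<^sub>F n in sequentially. norm q ^ n < r"
    using assms by (intro order_tendstoD) auto
  then obtain N where N: "\<And>n. n \<ge> N \<Longrightarrow> norm q ^ n < r"
    by (auto simp: eventually_sequentially)
  have "norm (q ^ (n\<^sup>2 + t * n)) \<le> (1 / r ^ N) * r ^ n" for n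
  proof (cases "n \<ge> N")
    case True
    have "norm (q ^ (n\<^sup>2 + t * n)) \<le> norm q ^ (n * n)"
      using assms by (simp add: norm_power power2_eq_square power_decreasing)
    also have "\<dots> \<le> r ^ n"
      unfolding power_mult using N[OF True] by (intro power_mono) auto
    also have "\<dots> \<le> (1 / r ^ N) * r ^ n"
      using assms by (simp add: divide_simps power_le_one mult_left_le)
    finally show ?thesis .
  next
    case False
    have "norm (q ^ (n\<^sup>2 + t * n)) \<le> 1"
      using assms by (simp add: norm_power power_le_one)
    also have "1 \<le> (1 / r ^ N) * r ^ n"
      using assms False by (simp add: divide_simps power_decreasing)
    finally show ?thesis .
  qed
  then show ?thesis by blast
qed

section \<open>The four kinds of series as graded families\<close>

lemma enumerates_nth:
  assumes "\<And>n. norm (fps_nth f n) \<le> \<rho> ^ n"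
  shows "enumerates (\<lambda>n. n) (fps_nth f) f"
  by (rule enumerates_inj[where \<rho> = \<rho>]) (use assms in auto)

lemma enumerates_qexp:
  assumes "norm p < 1"
  shows "enumerates (\<lambda>n. n) (fps_nth (fps_qexp p c)) (fps_qexp p c)"
proof (rule enumerates_nth)
  fix n
  show "norm (fps_nth (fps_qexp p c) n) \<le> (norm c * (1 / (1 - norm p))) ^ n"
    using mult_left_mono[OF norm_inverse_qpoch_self_le[OF assms, of n], of "norm c ^ n"]
    by (simp add: fps_qexp_def norm_divide norm_mult norm_power power_mult_distrib divide_inverse
        norm_inverse)
qed

lemma enumerates_qExp:
  assumes "norm p < 1"
  shows "enumerates (\<lambda>n. n) (fps_nth (fps_qExp p c)) (fps_qExp p c)"
proof (rule enumerates_nth)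
  fix n
  have "norm (p ^ (n choose 2)) * norm (c ^ n * inverse (qpoch p p n))
      \<le> 1 * norm (c ^ n * inverse (qpoch p p n))"
    using assms by (intro mult_right_mono) (auto simp: norm_power power_le_one)
  also have "\<dots> \<le> (norm c * (1 / (1 - norm p))) ^ n"
    unfolding mult_1 norm_mult norm_power power_mult_distrib
    by (intro mult_left_mono norm_inverse_qpoch_self_le[OF assms]) simp
  finally show "norm (fps_nth (fps_qExp p c) n) \<le> (norm c * (1 / (1 - norm p))) ^ n"
    by (simp add: fps_qExp_def norm_mult divide_inverse mult_ac)
qed

lemma enumerates_q_binomial:
  assumes "norm p < 1"
  shows "enumerates (\<lambda>n. n) (\<lambda>n. qpoch y p n * c ^ n / qpoch p p n)
    (Abs_fps (\<lambda>n. qpoch y p n * c ^ n / qpoch p p n))"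
proof -
  have "norm (qpoch y p n * c ^ n / qpoch p p n)
      \<le> ((1 + norm y) * (norm c * (1 / (1 - norm p)))) ^ n" for n
  proof -
    have "norm (qpoch y p n) * (norm c ^ n * norm (inverse (qpoch p p n)))
        \<le> (1 + norm y) ^ n * (norm c ^ n * (1 / (1 - norm p)) ^ n)"
      using assms norm_inverse_qpoch_self_le[OF assms] norm_qpoch_le[OF assms]
      by (intro mult_mono) auto
    then show ?thesis
      by (simp only: norm_mult norm_power power_mult_distrib divide_inverse mult_ac)
  qed
  then show ?thesis
    by (intro enumerates_inj) auto
qed

lemma enumerates_even:
  assumes "norm p < 1"
  shows "enumerates (\<lambda>i. 2 * i) (\<lambda>i. c ^ (2 * i) / qpoch p p i)
    (Abs_fps (\<lambda>n. if even n then c ^ n / qpoch p p (n div 2) else 0))"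
proof (rule enumerates_inj)
  show "inj (\<lambda>i::nat. 2 * i)" by (simp add: inj_def)
  fix i
  \<comment> \<open>The index \<open>i\<close> has degree \<open>2 * i\<close>, so the bound with
    exponent \<open>i\<close> is weakened to one with exponent \<open>2 * i\<close>.\<close>
  have "1 \<le> 1 / (1 - norm p)"
    using assms by simp
  then have "(1 / (1 - norm p)) ^ i \<le> (1 / (1 - norm p)) ^ (2 * i)"
    by (intro power_increasing) auto
  with norm_inverse_qpoch_self_le[OF assms, of i]
  have "norm (inverse (qpoch p p i)) \<le> (1 / (1 - norm p)) ^ (2 * i)" by linarith
  then have "norm c ^ (2 * i) * norm (inverse (qpoch p p i))
      \<le> norm c ^ (2 * i) * (1 / (1 - norm p)) ^ (2 * i)"
    by (rule mult_left_mono) simp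
  then show "norm (c ^ (2 * i) / qpoch p p i) \<le> (norm c * (1 / (1 - norm p))) ^ (2 * i)"
    by (simp only: norm_mult norm_power power_mult_distrib divide_inverse)
qed auto

section \<open>Resummation of the triple series and the two identities\<close>

text \<open>Once the powers of \<open>q\<close> are collected, the only one depending on
  \<open>i\<close> is \<open>Q^((A - i) (B - i))\<close>, which leaves the q-Vandermonde sum at
  \<open>y = -1\<close>.\<close>

lemma sum_even_mult_qExp:
  fixes q x :: complex
  assumes q: "norm q < 1" and x: "x \<noteq> 0"
  defines "Q \<equiv> q\<^sup>2"
  shows "(\<Sum>i\<le>min A B. q ^ ((A + B)\<^sup>2 + t * (A + B)) *
            ((q ^ t) ^ (2 * i) / qpoch (Q\<^sup>2) (Q\<^sup>2) i * (fps_nth (fps_qExp Q (x * q ^ t)) (A - i)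
              * fps_nth (fps_qExp Q (q ^ (2 + t) / x)) (B - i))))
       = qpoch (- Q) Q (A + B) * (fps_nth (fps_qExp (Q\<^sup>2) (q ^ (1 + 2 * t) * x)) A
              * fps_nth (fps_qExp (Q\<^sup>2) (q ^ (3 + 2 * t) / x)) B)"
proof -
  have Q: "norm Q < 1"
    using q by (simp add: Q_def norm_power power_less_one_iff)
  \<comment> \<open>The exponent of \<open>q\<close> independent of \<open>i\<close>; it is exactly
    the one carried by the two coefficients in base \<open>Q^2 = q^4\<close> on the right.\<close>
  define e where "e = 4 * (A choose 2) + (1 + 2 * t) * A + 4 * (B choose 2) + (3 + 2 * t) * B"
  define K where "K = x ^ A / x ^ B * q ^ e"
  define V where "V i = Q ^ ((A - i) * (B - i))
      / (qpoch Q Q (A - i) * qpoch Q Q (B - i) * qpoch Q Q i * qpoch (- 1 * Q) Q i)" for i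
  have "q ^ ((A + B)\<^sup>2 + t * (A + B)) *
            ((q ^ t) ^ (2 * i) / qpoch (Q\<^sup>2) (Q\<^sup>2) i * (fps_nth (fps_qExp Q (x * q ^ t)) (A - i)
              * fps_nth (fps_qExp Q (q ^ (2 + t) / x)) (B - i))) = K * V i"
    if "i \<le> min A B" for i
  proof -
    obtain a b where ab: "A = a + i" "B = b + i"
      using \<open>i \<le> min A B\<close> by (metis add.commute le_Suc_ex min.bounded_iff)
    have "(A + B)\<^sup>2 + t * (A + B) + t * (2 * i) + (t * a + 2 * (a choose 2))
          + ((2 + t) * b + 2 * (b choose 2))
        = e + 2 * (a * b)"
      using two_mult_choose_two[of a] two_mult_choose_two[of b] two_mult_choose_two[of A]
        two_mult_choose_two[of B]
      by (simp add: e_def ab power2_eq_square algebra_simps)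
    then have exps: "q ^ ((A + B)\<^sup>2 + t * (A + B)) * (q ^ t) ^ (2 * i)
          * ((q ^ t) ^ a * Q ^ (a choose 2)) * ((q ^ (2 + t)) ^ b * Q ^ (b choose 2))
        = q ^ e * Q ^ (a * b)"
      unfolding Q_def power_mult[symmetric] power_add[symmetric] by (simp only: add.assoc)
    have xs: "x ^ A / x ^ B = x ^ a / x ^ b"
      using x by (simp add: ab power_add)
    have diffs: "A - i = a" "B - i = b"
      by (simp_all add: ab)
    have "K * V i = x ^ a / x ^ b * (q ^ e * Q ^ (a * b))
        / (qpoch Q Q a * qpoch Q Q b * (qpoch Q Q i * qpoch (- Q) Q i))"
      unfolding K_def V_def xs diffs by (simp add: mult_ac)
    then show ?thesis
      unfolding exps[symmetric] fps_qExp_def fps_nth_Abs_fps power_mult_distrib power_divide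
        qpoch_mult_uminus[symmetric] diffs
      by (simp add: mult_ac)
  qed
  then have "(\<Sum>i\<le>min A B. q ^ ((A + B)\<^sup>2 + t * (A + B)) *
            ((q ^ t) ^ (2 * i) / qpoch (Q\<^sup>2) (Q\<^sup>2) i * (fps_nth (fps_qExp Q (x * q ^ t)) (A - i)
              * fps_nth (fps_qExp Q (q ^ (2 + t) / x)) (B - i)))) = K * (\<Sum>i\<le>min A B. V i)"
    by (simp add: sum_distrib_left)
  also have "(\<Sum>i\<le>min A B. V i)
      = qpoch (- Q) Q (A + B) / (qpoch (Q\<^sup>2) (Q\<^sup>2) A * qpoch (Q\<^sup>2) (Q\<^sup>2) B)"
  proof -
    have "- 1 * Q * Q ^ i \<noteq> 1" for i
      using one_plus_power_neq_0[OF Q, of i] by (simp add: neg_eq_iff_add_eq_0 add.commute)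
    from q_vandermonde[OF Q this, of A B] show ?thesis
      unfolding V_def qpoch_mult_uminus[symmetric] by (simp add: mult_ac)
  qed
  also have "K * \<dots> = qpoch (- Q) Q (A + B) * (fps_nth (fps_qExp (Q\<^sup>2) (q ^ (1 + 2 * t) * x)) A
              * fps_nth (fps_qExp (Q\<^sup>2) (q ^ (3 + 2 * t) / x)) B)"
    unfolding K_def e_def fps_qExp_def Q_def
    by (simp add: power_mult_distrib power_divide power_add distrib_left distrib_right mult_ac
        flip: power_mult)
  finally show ?thesis .
qed

lemma triple_has_sum:
  fixes q x :: complex
  assumes q: "norm q < 1" and x: "x \<noteq> 0" and t: "t = 0 \<or> t = 1"
  defines "Q \<equiv> q\<^sup>2"
  shows "((\<lambda>(j, k, l). q ^ ((j + (k + l))\<^sup>2 + t * (j + (k + l))) *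
            (1 / qpoch q q j * (qpoch x Q k * (- (q ^ t)) ^ k / qpoch Q Q k
              * ((q ^ (2 + t) / x) ^ l * Q ^ (l choose 2) / qpoch Q Q l))))
          has_sum (qpoch_inf (- (q ^ (1 + 2 * t)) * x) (q ^ 4)
              * qpoch_inf (- (q ^ (3 + 2 * t)) / x) (q ^ 4) / qpoch_inf Q (q ^ 4))) UNIV"
proof -
  have Q: "norm Q < 1"
    using q by (simp add: Q_def norm_power power_less_one_iff)
  have Q2: "norm (Q\<^sup>2) < 1"
    using Q by (simp add: norm_power power_less_one_iff)
  define w where "w n = q ^ (n\<^sup>2 + t * n)" for n
  have w: "\<exists>C. \<forall>n. norm (w n) \<le> C * r ^ n" if "0 < r" "r < 1" for r
    unfolding w_def by (rule norm_power_square_le_geometric[OF q that])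
  define bin where "bin k = qpoch x Q k * (- (q ^ t)) ^ k / qpoch Q Q k" for k
  define ev where "ev i = (q ^ t) ^ (2 * i) / qpoch (Q\<^sup>2) (Q\<^sup>2) i" for i
  define E1 where "E1 = fps_qExp Q (x * q ^ t)"
  define E2 where "E2 = fps_qExp Q (q ^ (2 + t) / x)"
  \<comment> \<open>One half of \<open>1 / (z; q)_inf\<close> is \<open>1 / (q^t z; Q)_inf\<close>,
    which goes into \<open>Ev\<close>; \<open>H\<close> is the other half. The exponent
    \<open>1 - t\<close> swaps the halves between \<open>t = 0\<close> and
    \<open>t = 1\<close>.\<close>
  define H where "H = fps_qexp Q (q ^ (1 - t))"
  define Ev where "Ev = Abs_fps (\<lambda>n. if even n then (q ^ t) ^ n / qpoch (Q\<^sup>2) (Q\<^sup>2) (n div 2) else 0)"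
  define U1 where "U1 = fps_qExp (Q\<^sup>2) (q ^ (1 + 2 * t) * x)"
  define U2 where "U2 = fps_qExp (Q\<^sup>2) (q ^ (3 + 2 * t) / x)"
  have fps_eq: "fps_qexp q 1 * (Abs_fps bin * E2) = (Ev * (E1 * E2)) * H"
  proof -
    have "fps_qexp q 1 = fps_qexp Q (q ^ t) * H"
      using t fps_qexp_split_base[OF q] by (auto simp: H_def Q_def mult.commute)
    moreover have "Abs_fps bin = E1 * fps_qexp Q (- (q ^ t))"
      using fps_q_binomial[OF Q, of x "- (q ^ t)"] unfolding bin_def[abs_def] by (simp add: E1_def)
    moreover have "fps_qexp Q (q ^ t) * fps_qexp Q (- (q ^ t)) = Ev"
      unfolding Ev_def by (rule fps_qexp_mult_uminus[OF Q])
    ultimately show ?thesis by (metis (no_types, opaque_lifting) mult.assoc mult.commute)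
  qed
  \<comment> \<open>The common value of the triple and the quadruple sum, by
    \<open>fps_eq\<close>.\<close>
  define S where "S = (\<Sum>\<^sub>\<infinity>n. w n * fps_nth ((Ev * (E1 * E2)) * H) n)"
  have triple: "((\<lambda>(j, k, l). w (j + (k + l)) * (fps_nth (fps_qexp q 1) j * (bin k * fps_nth E2 l)))
      has_sum S) UNIV"
  proof -
    have "enumerates (\<lambda>n. n) bin (Abs_fps bin)"
      unfolding bin_def[abs_def] by (rule enumerates_q_binomial[OF Q])
    from enumerates_weighted_has_sum[OF enumerates_mult[OF enumerates_qexp[OF q, of 1]
        enumerates_mult[OF this enumerates_qExp[OF Q, of "q ^ (2 + t) / x"]]] w]
    show ?thesis
      unfolding E2_def[symmetric] fps_eq S_def[symmetric] by (simp add: case_prod_unfold)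
  qed
  have "((\<lambda>((i, a, b), h). w (2 * i + (a + b) + h)
      * (ev i * (fps_nth E1 a * fps_nth E2 b) * fps_nth H h))
      has_sum S) UNIV"
  proof -
    have "enumerates (\<lambda>i. 2 * i) ev Ev"
      unfolding ev_def[abs_def] Ev_def by (rule enumerates_even[OF Q2])
    from enumerates_weighted_has_sum[OF enumerates_mult[OF enumerates_mult[OF this
        enumerates_mult[OF enumerates_qExp[OF Q, of "x * q ^ t"]
        enumerates_qExp[OF Q, of "q ^ (2 + t) / x"]]]
        enumerates_qexp[OF Q, of "q ^ (1 - t)"]] w]
    show ?thesis
      unfolding E1_def[symmetric] E2_def[symmetric] H_def[symmetric] S_def[symmetric]
      by (simp add: case_prod_unfold)
  qed
  then have quad: "((\<lambda>((i, a, b), h). w (2 * i + (a + b) + h)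
      * (ev i * (fps_nth E1 a * fps_nth E2 b) * fps_nth H h))
      has_sum S) (Sigma UNIV (\<lambda>_. UNIV))"
    by simp
  have euler: "((\<lambda>h. w (s + h) * (c * fps_nth H h)) has_sum
      w s * c * qpoch_inf (- Q * Q ^ s) Q) UNIV"
    for s c
  proof -
    have eq: "w (s + h) * (c * fps_nth H h) = w s * c * fps_nth (fps_qExp Q (Q * Q ^ s)) h" for h
    proof -
      \<comment> \<open>The terms \<open>t * h\<close> cancel and
        \<open>h^2 + h = 2 * (h choose 2) + 2 * h\<close>, so the weight turns the coefficients of
        \<open>H\<close> into those of \<open>fps_qExp\<close> at \<open>Q^(s+1)\<close>, for either
        value of \<open>t\<close>.\<close>
      have "(s + h)\<^sup>2 + t * (s + h) + (1 - t) * h = s\<^sup>2 + t * s + ((2 + 2 * s) * h + 2 * (h choose 2))"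
        using t two_mult_choose_two[of h] by (auto simp: power2_eq_square algebra_simps)
      then have "w (s + h) * (q ^ (1 - t)) ^ h = w s * ((Q * Q ^ s) ^ h * Q ^ (h choose 2))"
        unfolding w_def Q_def power_Suc[symmetric] power_mult[symmetric] power_add[symmetric]
        by (simp only: mult.assoc)
      then show ?thesis
        by (simp add: H_def fps_qexp_def fps_qExp_def mult_ac)
    qed
    show ?thesis
      unfolding eq using has_sum_cmult_right[OF qExp_has_sum[OF Q, of "Q * Q ^ s"], of "w s * c"]
      by simp
  qed
  define g where "g = (\<lambda>(i, a, b). w (2 * i + (a + b)) * (ev i * (fps_nth E1 a * fps_nth E2 b))
      * qpoch_inf (- Q * Q ^ (2 * i + (a + b))) Q)"
  have "(g has_sum S) UNIV"
    by (rule has_sum_SigmaD[OF quad]) (auto simp: g_def intro!: euler[simplified])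
  \<comment> \<open>New indices \<open>A = a + i\<close>, \<open>B = b + i\<close>: the degree
    \<open>2 i + a + b\<close> becomes \<open>A + B\<close>, and \<open>i\<close> runs over the
    finite range up to \<open>min A B\<close>.\<close>
  moreover have "((\<lambda>((A, B), i). g (i, A - i, B - i)) has_sum S) (Sigma UNIV (\<lambda>(A, B). {..min A B}))
      \<longleftrightarrow> (g has_sum S) UNIV"
    by (rule has_sum_reindex_bij_witness[where i = "\<lambda>(i, a, b). ((a + i, b + i), i)"
          and j = "\<lambda>((A, B), i). (i, A - i, B - i)"]) auto
  ultimately have sigma:
    "((\<lambda>((A, B), i). g (i, A - i, B - i)) has_sum S) (Sigma UNIV (\<lambda>(A, B). {..min A B}))"
    by simp
  define c where "c = qpoch_inf (- Q) Q"
  have "((\<lambda>(A, B). c * (fps_nth U1 A * fps_nth U2 B)) has_sum S) UNIV"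
  proof (rule has_sum_SigmaD[OF sigma])
    fix AB :: "nat \<times> nat"
    obtain A B where AB: "AB = (A, B)" by fastforce
    have nz: "qpoch (- Q) Q (A + B) \<noteq> 0"
      using one_plus_power_neq_0[OF Q] by (simp add: qpoch_def)
    have "qpoch (- Q) Q (A + B) * qpoch_inf (- Q * Q ^ (A + B)) Q = c"
      unfolding c_def by (rule qpoch_mult_qpoch_inf[OF Q])
    \<comment> \<open>This factor depends on \<open>A + B\<close> alone, and its denominator cancels
      the numerator of the q-Vandermonde sum.\<close>
    then have rest: "qpoch_inf (- Q * Q ^ (A + B)) Q = c / qpoch (- Q) Q (A + B)"
      using nz by (simp add: field_simps)
    have "(\<Sum>i\<le>min A B. g (i, A - i, B - i))
        = (\<Sum>i\<le>min A B. w (A + B) * (ev i * (fps_nth E1 (A - i) * fps_nth E2 (B - i)))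
            * (c / qpoch (- Q) Q (A + B)))"
    proof (rule sum.cong[OF refl])
      fix i assume "i \<in> {..min A B}"
      then have "2 * i + (A - i + (B - i)) = A + B" by auto
      then show "g (i, A - i, B - i) = w (A + B) * (ev i * (fps_nth E1 (A - i) * fps_nth E2 (B - i)))
            * (c / qpoch (- Q) Q (A + B))"
        unfolding g_def prod.case by (simp only: rest)
    qed
    also have "\<dots> = c * (fps_nth U1 A * fps_nth U2 B)"
      unfolding sum_distrib_right[symmetric] w_def ev_def E1_def E2_def U1_def U2_def Q_def
        sum_even_mult_qExp[OF q x]
      using nz by (simp add: Q_def)
    finally have "(\<Sum>i\<le>min A B. g (i, A - i, B - i)) = c * (fps_nth U1 A * fps_nth U2 B)" .
    then show "((\<lambda>i. (\<lambda>((A, B), i). g (i, A - i, B - i)) (AB, i)) has_sum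
         (\<lambda>(A, B). c * (fps_nth U1 A * fps_nth U2 B)) AB) ((\<lambda>(A, B). {..min A B}) AB)"
      unfolding AB by (auto intro!: has_sum_finiteI)
  qed
  then have "((\<lambda>(A, B). c * (fps_nth U1 A * fps_nth U2 B)) has_sum S) (Sigma UNIV (\<lambda>_. UNIV))"
    by simp
  then have "((\<lambda>A. c * (fps_nth U1 A * qpoch_inf (- (q ^ (3 + 2 * t) / x)) (Q\<^sup>2))) has_sum S) UNIV"
    by (rule has_sum_SigmaD) (auto simp: U2_def intro!: has_sum_cmult_right qExp_has_sum[OF Q2])
  moreover have "((\<lambda>A. c * (fps_nth U1 A * qpoch_inf (- (q ^ (3 + 2 * t) / x)) (Q\<^sup>2))) has_sum
      c * (qpoch_inf (- (q ^ (1 + 2 * t) * x)) (Q\<^sup>2) * qpoch_inf (- (q ^ (3 + 2 * t) / x)) (Q\<^sup>2))) UNIV"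
    by (auto simp: U1_def intro!: has_sum_cmult_right has_sum_cmult_left qExp_has_sum[OF Q2])
  ultimately have "S = c * (qpoch_inf (- (q ^ (1 + 2 * t) * x)) (Q\<^sup>2)
      * qpoch_inf (- (q ^ (3 + 2 * t) / x)) (Q\<^sup>2))"
    by (rule has_sum_unique)
  moreover have "c * qpoch_inf Q (Q\<^sup>2) = 1"
    unfolding c_def by (rule qpoch_inf_uminus_mult[OF Q])
  then have "c = 1 / qpoch_inf Q (Q\<^sup>2)"
    by (metis eq_divide_eq mult_zero_right zero_neq_one)
  moreover have "Q\<^sup>2 = q ^ 4"
    by (simp add: Q_def flip: power_mult)
  ultimately have "S = qpoch_inf (- (q ^ (1 + 2 * t)) * x) (q ^ 4)
              * qpoch_inf (- (q ^ (3 + 2 * t)) / x) (q ^ 4) / qpoch_inf Q (q ^ 4)"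
    by simp
  with triple show ?thesis
    by (simp add: w_def bin_def E2_def fps_qexp_def fps_qExp_def)
qed

theorem theorem4p4:
  fixes q x :: complex
  assumes "norm q < 1" and "x \<noteq> 0"
  shows "((\<lambda>(j, k, l).
            qpoch x (q\<^sup>2) k * (-1) ^ k * x powi (- int l)
              / (qpoch q q j * qpoch (q\<^sup>2) (q\<^sup>2) k * qpoch (q\<^sup>2) (q\<^sup>2) l)
              * q ^ ((j + k + l) * (j + k + l - 1) + l\<^sup>2 + j + k + 2 * l))
          has_sum
            (qpoch_inf (- q * x) (q ^ 4) * qpoch_inf (- (q ^ 3) / x) (q ^ 4)
              / qpoch_inf (q\<^sup>2) (q ^ 4))) (UNIV :: (nat \<times> nat \<times> nat) set)
       \<and> ((\<lambda>(j, k, l).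
            qpoch x (q\<^sup>2) k * (-1) ^ k * x powi (- int l)
              / (qpoch q q j * qpoch (q\<^sup>2) (q\<^sup>2) k * qpoch (q\<^sup>2) (q\<^sup>2) l)
              * q ^ ((j + k + l) * (j + k + l - 1) + l\<^sup>2 + 2 * j + 3 * k + 4 * l))
          has_sum
            (qpoch_inf (- (q ^ 3) * x) (q ^ 4) * qpoch_inf (- (q ^ 5) / x) (q ^ 4)
              / qpoch_inf (q\<^sup>2) (q ^ 4))) (UNIV :: (nat \<times> nat \<times> nat) set)"
proof -
  \<comment> \<open>The exponent in the statement uses truncated subtraction; adding
    \<open>n\<close> gives \<open>n * n\<close> even at \<open>n = 0\<close>.\<close>
  have pred: "n * (n - 1) + n = n * n" for n :: nat
    by (cases n) auto
  \<comment> \<open>The linear part \<open>(1 + t) j + (1 + 2 t) k + (2 + 2 t) l\<close> gives the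
    exponents of the first identity at \<open>t = 0\<close> and of the second at
    \<open>t = 1\<close>.\<close>
  have term_eq: "q ^ ((j + (k + l))\<^sup>2 + t * (j + (k + l))) *
            (1 / qpoch q q j * (qpoch x (q\<^sup>2) k * (- (q ^ t)) ^ k / qpoch (q\<^sup>2) (q\<^sup>2) k
              * ((q ^ (2 + t) / x) ^ l * (q\<^sup>2) ^ (l choose 2) / qpoch (q\<^sup>2) (q\<^sup>2) l)))
      = qpoch x (q\<^sup>2) k * (-1) ^ k * x powi (- int l)
              / (qpoch q q j * qpoch (q\<^sup>2) (q\<^sup>2) k * qpoch (q\<^sup>2) (q\<^sup>2) l)
              * q ^ ((j + k + l) * (j + k + l - 1) + l\<^sup>2
                  + (1 + t) * j + (1 + 2 * t) * k + (2 + 2 * t) * l)"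
    for j k l t
  proof -
    have "(j + (k + l))\<^sup>2 + t * (j + (k + l)) + t * k + (2 + t) * l + 2 * (l choose 2)
        = (j + k + l) * (j + k + l - 1) + l\<^sup>2 + (1 + t) * j + (1 + 2 * t) * k + (2 + 2 * t) * l"
      using two_mult_choose_two[of l] pred[of "j + k + l"]
      by (simp add: power2_eq_square algebra_simps)
    then have "q ^ ((j + (k + l))\<^sup>2 + t * (j + (k + l)))
          * (q ^ t) ^ k * (q ^ (2 + t)) ^ l * (q\<^sup>2) ^ (l choose 2)
        = q ^ ((j + k + l) * (j + k + l - 1) + l\<^sup>2 + (1 + t) * j + (1 + 2 * t) * k + (2 + 2 * t) * l)"
      unfolding power_mult[symmetric] power_add[symmetric] by (simp only:)
    note exps = this[symmetric]
    have "x powi (- int l) = 1 / x ^ l"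
      by (simp add: power_int_minus divide_inverse)
    then show ?thesis
      unfolding exps power_minus[of "q ^ t"] power_divide by (simp add: mult_ac)
  qed
  have nums: "1 + 1 = (2 :: nat)" "1 + 2 * 1 = (3 :: nat)" "2 + 2 * 1 = (4 :: nat)"
      "3 + 2 * 1 = (5 :: nat)"
    by simp_all
  show ?thesis
    using triple_has_sum[OF assms, of 0] triple_has_sum[OF assms, of 1]
    unfolding term_eq nums by simp
qed

end
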